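(* Let $\lambda>1$, $s_0=\pi/\sqrt{\lambda^2-1}$, $\sigma\in[0,s_0]$, and $$L_0=\frac{4\pi}{\sqrt{3\left(\lambda+\cos(\sigma\sqrt{\lambda^2-1})\right)\sqrt{\lambda^2-1}}}.$$ If $L>L_0$, then the translating $\lambda$-soliton $\Sigma(\sigma;L)$ (with respect to the density vector $\mathbf{v}=(0,0,1)$) is unstable.
   Context: Let $\mathbf{v}=(0,0,1)$ and $\phi(x)=\langle x,\mathbf{v}\rangle=x_3$; the weighted area element is $dA_\phi=e^{x_3}dA$. An oriented immersed surface with Gauss map $N$ is a translating $\lambda$-soliton with respect to $\mathbf{v}$ if its mean curvature $H$ (sum of the principal curvatures, with sign convention $H=\mathrm{trace}(-dN)$) satisfies $H=\langle N,\mathbf{v}\rangle+\lambda$. For $\lambda>1$ define the arc-length parametrized curve $\alpha=(\alpha_1,0,\alpha_3):\mathbb{R}\to\mathbb{R}^3$ by $$\alpha_1(s)=-\lambda s+2\arctan\left(\sqrt{\tfrac{\lambda+1}{\lambda-1}}\tan\left(\tfrac{s}{2}\sqrt{\lambda^2-1}\right)\right),\qquad \alpha_3(s)=\log\left(\lambda-\cos(s\sqrt{\lambda^2-1})\right),$$ where the branch of $\arctan$ is chosen so that $\alpha_1$ is smooth on $\mathbb{R}$ with $\alpha_1(0)=0$; equivalently $\alpha_1'(s)=-\lambda+\frac{\lambda^2-1}{\lambda-\cos(s\sqrt{\lambda^2-1})}$. The immersed cylindrical surface $\Psi(s,t)=(\alpha_1(s),t,\alpha_3(s))$, with Gauss map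 $N=(-\alpha_3',0,\alpha_1')$, is a translating $\lambda$-soliton. With $s_0=\pi/\sqrt{\lambda^2-1}$ (half the period of $\alpha$), for $\sigma\in[0,s_0]$ and $L>0$ let $$\Sigma(\sigma;L)=\{(\alpha_1(s),t,\alpha_3(s)): s\in[-s_0+\sigma,s_0+\sigma],\ t\in[0,L]\},$$ regarded as an immersed compact surface with boundary, parametrized by $[-s_0+\sigma,s_0+\sigma]\times[0,L]$. Stability: for a smooth function $u$ on a compact translating $\lambda$-soliton $\Sigma$ vanishing on $\partial\Sigma$, the second variation of the weighted area for variations fixing the boundary with normal component $u$ is $Q_\phi(u)=-\int_\Sigma u(\Delta u+\langle\nabla u,\mathbf{v}\rangle+|A|^2u)\,dA_\phi=\int_\Sigma(|\nabla u|^2-|A|^2u^2)\,dA_\phi$, where $\Delta,\nabla$ are the Laplacian and gradient of $\Sigma$ and $A$ its second fundamental form. $\Sigma$ is stable if $Q_\phi(u)\ge0$ for all such $u$ with $\int_\Sigma u\,dA_\phi=0$ (volume preserving variations), and unstable if it is not stable, i.e. if there is such a $u$ with $u=0$ on $\partial\Sigma$, $\int_\Sigma u\,dA_\phi=0$ and $Q_\phi(u)<0$. *)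

theory Defs
  imports "HOL-Analysis.Analysis"
begin

section \<open>Smooth functions\<close>

primrec Ck_on :: "nat \<Rightarrow> 'a::real_normed_vector set \<Rightarrow> ('a \<Rightarrow> 'b::real_normed_vector) \<Rightarrow> bool" where
  "Ck_on 0 U f \<longleftrightarrow> continuous_on U f"
| "Ck_on (Suc k) U f \<longleftrightarrow>
     (\<forall>x\<in>U. f differentiable (at x)) \<and> (\<forall>v. Ck_on k U (\<lambda>x. frechet_derivative f (at x) v))"

text \<open>On a set that need not be open (here a compact rectangle), smooth means: equal to a smooth
  function near the set. Only values and derivatives at points of the set are used below.\<close>

definition smooth_near :: "'a::real_normed_vector set \<Rightarrow> ('a \<Rightarrow> 'b::real_normed_vector) \<Rightarrow> bool" where
  "smooth_near K f \<longleftrightarrow> (\<exists>U. open U \<and> K \<subseteq> U \<and> (\<forall>k. Ck_on k U f))"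

section \<open>Parametrized surfaces in Euclidean 3-space\<close>

text \<open>A surface is an immersion \<open>X\<close> of a parameter domain \<open>K\<close> in the plane; functions and fields on
  the surface are functions of the parameter \<open>p = (s, t)\<close>. The boundary of the immersed surface
  corresponds to \<open>frontier K\<close>.\<close>

type_synonym surf = "real \<times> real \<Rightarrow> real^3"

definition e_par :: "2 \<Rightarrow> real \<times> real" where
  "e_par i = (if i = 1 then (1, 0) else (0, 1))"

definition partial_d :: "(real \<times> real \<Rightarrow> 'b::real_normed_vector) \<Rightarrow> 2 \<Rightarrow> real \<times> real \<Rightarrow> 'b" where
  "partial_d f i p = frechet_derivative f (at p) (e_par i)"

definition first_form :: "surf \<Rightarrow> real \<times> real \<Rightarrow> real^2^2" where
  "first_form X p = (\<chi> i j. partial_d X i p \<bullet> partial_d X j p)"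

definition gauss_map :: "surf \<Rightarrow> surf" where
  "gauss_map X p = sgn (cross3 (partial_d X 1 p) (partial_d X 2 p))"

definition second_form :: "surf \<Rightarrow> real \<times> real \<Rightarrow> real^2^2" where
  "second_form X p = (\<chi> i j. - (partial_d (gauss_map X) i p \<bullet> partial_d X j p))"

text \<open>The matrix of \<open>-dN\<close> in the coordinate basis of the tangent plane. Its trace is the sum of the
  principal curvatures, and the trace of its square the sum of their squares, i.e. the squared
  norm of the second fundamental form with respect to the induced metric.\<close>

definition shape_op :: "surf \<Rightarrow> real \<times> real \<Rightarrow> real^2^2" where
  "shape_op X p = matrix_inv (first_form X p) ** second_form X p"

definition mean_curv :: "surf \<Rightarrow> real \<times> real \<Rightarrow> real" where
  "mean_curv X p = trace (shape_op X p)"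

definition norm_A_sq :: "surf \<Rightarrow> real \<times> real \<Rightarrow> real" where
  "norm_A_sq X p = trace (shape_op X p ** shape_op X p)"

text \<open>The gradient on the surface, as a tangent vector in the ambient space:
  the sum of \<open>g\<^sup>i\<^sup>j (\<partial>\<^sub>j u) (\<partial>\<^sub>i X)\<close>.\<close>

definition surf_grad :: "surf \<Rightarrow> (real \<times> real \<Rightarrow> real) \<Rightarrow> surf" where
  "surf_grad X u p =
     (\<Sum>i\<in>UNIV. (matrix_inv (first_form X p) *v (\<chi> j. partial_d u j p)) $ i *\<^sub>R partial_d X i p)"

text \<open>Integration against \<open>e\<^bsup>\<langle>x, v\<rangle>\<^esup> dA\<close>.\<close>

definition weighted_integral ::
  "real^3 \<Rightarrow> surf \<Rightarrow> (real \<times> real) set \<Rightarrow> (real \<times> real \<Rightarrow> real) \<Rightarrow> real" where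
  "weighted_integral v X K f =
     integral K (\<lambda>p. f p * (exp (X p \<bullet> v) * sqrt (det (first_form X p))))"

definition second_variation ::
  "real^3 \<Rightarrow> surf \<Rightarrow> (real \<times> real) set \<Rightarrow> (real \<times> real \<Rightarrow> real) \<Rightarrow> real" where
  "second_variation v X K u =
     weighted_integral v X K (\<lambda>p. (norm (surf_grad X u p))\<^sup>2 - norm_A_sq X p * (u p)\<^sup>2)"

definition stable_surf :: "real^3 \<Rightarrow> surf \<Rightarrow> (real \<times> real) set \<Rightarrow> bool" where
  "stable_surf v X K \<longleftrightarrow>
     (\<forall>u. smooth_near K u \<and> (\<forall>p\<in>frontier K. u p = 0) \<and> weighted_integral v X K u = 0
        \<longrightarrow> second_variation v X K u \<ge> 0)"

definition unstable_surf :: "real^3 \<Rightarrow> surf \<Rightarrow> (real \<times> real) set \<Rightarrow> bool" where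
  "unstable_surf v X K \<longleftrightarrow> \<not> stable_surf v X K"

section \<open>The cylindrical solitons\<close>

text \<open>The branch of \<open>arctan (k tan x)\<close> that is continuous on the whole line and vanishes at \<open>0\<close>:
  on the interval of length \<open>\<pi>\<close> around \<open>n\<pi>\<close> it is \<open>arctan (k tan x) + n\<pi>\<close>, and at the poles of
  \<open>tan\<close> both one-sided limits are \<open>x\<close>.\<close>

definition arctan_tan :: "real \<Rightarrow> real \<Rightarrow> real" where
  "arctan_tan k x =
     (if cos x = 0 then x else arctan (k * tan x) + pi * of_int (round (x / pi)))"

definition alpha1 :: "real \<Rightarrow> real \<Rightarrow> real" where
  "alpha1 lam s =
     - lam * s + 2 * arctan_tan (sqrt ((lam + 1) / (lam - 1))) (s / 2 * sqrt (lam\<^sup>2 - 1))"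

definition alpha3 :: "real \<Rightarrow> real \<Rightarrow> real" where
  "alpha3 lam s = ln (lam - cos (s * sqrt (lam\<^sup>2 - 1)))"

definition soliton_cyl :: "real \<Rightarrow> surf" where
  "soliton_cyl lam = (\<lambda>(s, t). vector [alpha1 lam s, t, alpha3 lam s])"

definition cyl_domain :: "real \<Rightarrow> real \<Rightarrow> real \<Rightarrow> (real \<times> real) set" where
  "cyl_domain s0 \<sigma> L = {- s0 + \<sigma> .. s0 + \<sigma>} \<times> {0..L}"

section \<open>Basic facts about the curve and the surface\<close>

lemma arctan_tan_eq:
  assumes k: "k > 0"
  shows "arctan_tan k x =
    x + arctan ((k - 1) * (sin x * cos x) / ((cos x)\<^sup>2 + k * (sin x)\<^sup>2))"
proof (cases "cos x = 0")
  case True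
  then show ?thesis by (simp add: arctan_tan_def)
next
  case False
  define n where "n = round (x / pi)"
  define y where "y = x - pi * of_int n"
  define T where "T = tan x"
  have c: "cos y \<noteq> 0" "tan y = T"
  proof -
    have "cos y = cos x * cos (pi * of_int n)"
      by (simp add: y_def cos_diff mult.commute sin_int_times_real)
    moreover have "cos (pi * of_int n) \<noteq> 0"
      using sin_cos_squared_add[of "pi * of_int n"] by (auto simp: sin_int_times_real mult.commute)
    ultimately show "cos y \<noteq> 0" using False by simp
    show "tan y = T"
      unfolding T_def y_def tan_def
      using False \<open>cos (pi * of_int n) \<noteq> 0\<close>
      by (simp add: sin_diff cos_diff sin_int_times_real mult.commute)
  qed
  have "\<bar>of_int n - x / pi\<bar> \<le> 1/2" unfolding n_def by (rule of_int_round_abs_le)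
  then have "\<bar>of_int n - x / pi\<bar> * pi \<le> 1/2 * pi"
    by (intro mult_right_mono) auto
  moreover have "\<bar>of_int n - x / pi\<bar> * pi = \<bar>y\<bar>"
    unfolding y_def by (subst abs_of_pos[OF pi_gt_zero, symmetric], subst abs_mult[symmetric])
      (simp add: algebra_simps abs_minus_commute)
  ultimately have "\<bar>y\<bar> \<le> pi / 2" by simp
  moreover have "y \<noteq> pi/2" "y \<noteq> - (pi/2)" using c(1) by (metis cos_pi_half, metis cos_pi_half cos_minus)
  ultimately have y: "- (pi/2) < y" "y < pi/2" by (auto simp: abs_le_iff)
  have aT: "arctan T = y" using c(2) y arctan_tan by force
  define D where "D = arctan (k * T) - arctan T"
  have D: "\<bar>D\<bar> < pi / 2"
  proof -
    have "T > 0 \<Longrightarrow> arctan (k*T) > 0 \<and> arctan T > 0" using k by (simp add: arctan_monotone)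
    moreover have "T < 0 \<Longrightarrow> arctan (k*T) < 0 \<and> arctan T < 0" using k
      by (simp add: mult_pos_neg)
    moreover have "T = 0 \<Longrightarrow> D = 0" by (simp add: D_def)
    moreover note arctan_lbound[of T] arctan_ubound[of T] arctan_lbound[of "k*T"] arctan_ubound[of "k*T"]
    ultimately show ?thesis unfolding D_def abs_less_iff
      by (smt (verit) pi_gt_zero)
  qed
  have cD: "cos D \<noteq> 0" using D cos_gt_zero_pi[of D] by linarith
  have tD: "tan D = (k * T - T) / (1 + k * T * T)"
    unfolding D_def using cD unfolding D_def
    by (subst tan_diff) (auto simp: tan_arctan)
  have "arctan (tan D) = D" using D by (intro arctan_tan) (auto simp: abs_less_iff)
  then have "arctan (k * T) = y + arctan ((k * T - T) / (1 + k * T * T))"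
    using tD aT by (simp add: D_def)
  moreover have "(k * T - T) / (1 + k * T * T)
      = (k - 1) * (sin x * cos x) / ((cos x)\<^sup>2 + k * (sin x)\<^sup>2)"
  proof -
    have "(k - 1) * (sin x * cos x) = (k * T - T) * (cos x)\<^sup>2"
      using False by (simp add: T_def tan_def field_simps power2_eq_square)
    moreover have "(cos x)\<^sup>2 + k * (sin x)\<^sup>2 = (1 + k * T * T) * (cos x)\<^sup>2"
      using False by (simp add: T_def tan_def field_simps power2_eq_square)
    ultimately show ?thesis using False by simp
  qed
  ultimately show ?thesis
    using False by (simp add: arctan_tan_def y_def n_def T_def)
qed

lemma arctan_tan_deriv:
  assumes k: "k > 0"
  shows "(arctan_tan k has_real_derivative k / ((cos x)\<^sup>2 + k\<^sup>2 * (sin x)\<^sup>2)) (at x)"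
proof -
  define c where "c = cos x"
  define s where "s = sin x"
  have cs: "c\<^sup>2 + s\<^sup>2 = 1" by (simp add: c_def s_def)
  have pos: "a > 0 \<Longrightarrow> c\<^sup>2 + a * s\<^sup>2 > 0" for a
  proof -
    assume a: "a > 0"
    have "c\<^sup>2 > 0 \<or> s\<^sup>2 > 0" using cs by (metis add_0 zero_less_power2 zero_neq_one power2_eq_iff zero_power2)
    then show ?thesis using a by (auto intro: add_pos_nonneg add_nonneg_pos)
  qed
  define Q where "Q = c\<^sup>2 + k * s\<^sup>2"
  define P where "P = (k - 1) * (s * c)"
  have Q: "Q > 0" using pos[OF k] by (simp add: Q_def)
  have Q': "(cos x)\<^sup>2 + k * (sin x)\<^sup>2 \<noteq> 0" using Q by (simp add: Q_def c_def s_def)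
  have R: "c\<^sup>2 + k\<^sup>2 * s\<^sup>2 > 0" using pos[of "k\<^sup>2"] k by simp
  define P' where "P' = (k - 1) * (c\<^sup>2 - s\<^sup>2)"
  define Q1 where "Q1 = 2 * (k - 1) * (s * c)"
  have "((\<lambda>x. x + arctan ((k - 1) * (sin x * cos x) / ((cos x)\<^sup>2 + k * (sin x)\<^sup>2)))
      has_real_derivative (1 + (P' * Q - P * Q1) / (Q * Q) / (1 + (P / Q)\<^sup>2))) (at x)"
    using Q'
    by (auto intro!: derivative_eq_intros simp: P_def Q_def P'_def Q1_def c_def s_def)
       (simp add: field_simps power2_eq_square)
  moreover have "1 + (P' * Q - P * Q1) / (Q * Q) / (1 + (P / Q)\<^sup>2) = k / (c\<^sup>2 + k\<^sup>2 * s\<^sup>2)"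
  proof -
    have PQ: "Q\<^sup>2 + P\<^sup>2 = (c\<^sup>2 + k\<^sup>2 * s\<^sup>2) * (c\<^sup>2 + s\<^sup>2)"
      unfolding P_def Q_def by algebra
    define M where "M = P' * Q - P * Q1"
    have A: "Q\<^sup>2 + P\<^sup>2 > 0" using Q by (simp add: add_pos_nonneg)
    have "1 + (P / Q)\<^sup>2 = (Q\<^sup>2 + P\<^sup>2) / (Q * Q)"
      using Q by (simp add: power_divide add_divide_distrib power2_eq_square)
    then have "M / (Q * Q) / (1 + (P / Q)\<^sup>2) = M / (Q\<^sup>2 + P\<^sup>2)"
      using Q by simp
    then have "1 + M / (Q * Q) / (1 + (P / Q)\<^sup>2) = ((Q\<^sup>2 + P\<^sup>2) + M) / (Q\<^sup>2 + P\<^sup>2)"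
      using divide_self[of "Q\<^sup>2 + P\<^sup>2"] A
      by (simp only: add_divide_distrib[of "Q\<^sup>2 + P\<^sup>2" M])
    moreover have "(Q\<^sup>2 + P\<^sup>2) + M = k * (c\<^sup>2 + s\<^sup>2)\<^sup>2"
      unfolding M_def P_def Q_def P'_def Q1_def by algebra
    ultimately show ?thesis
      using PQ cs by (simp add: M_def)
  qed
  moreover have "arctan_tan k = (\<lambda>x. x + arctan ((k - 1) * (sin x * cos x) / ((cos x)\<^sup>2 + k * (sin x)\<^sup>2)))"
    using arctan_tan_eq[OF k] by auto
  ultimately show ?thesis by (simp add: c_def s_def)
qed

lemma alpha1_0: "alpha1 lam 0 = 0"
  by (simp add: alpha1_def arctan_tan_def)

lemma alpha1_deriv:
  assumes lam: "lam > 1"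
  shows "(alpha1 lam has_real_derivative
    (- lam + (lam\<^sup>2 - 1) / (lam - cos (s * sqrt (lam\<^sup>2 - 1))))) (at s)"
proof -
  define m where "m = sqrt (lam\<^sup>2 - 1)"
  define k where "k = sqrt ((lam + 1) / (lam - 1))"
  have l1: "lam\<^sup>2 > 1" using lam by (simp add: one_less_power)
  have m: "m > 0" "m\<^sup>2 = lam\<^sup>2 - 1" using l1 by (auto simp: m_def)
  have k: "k > 0" "k\<^sup>2 = (lam + 1) / (lam - 1)" using lam by (auto simp: k_def)
  define x where "x = s / 2 * m"
  have d: "((\<lambda>s. arctan_tan k (s / 2 * m)) has_real_derivative
      k / ((cos x)\<^sup>2 + k\<^sup>2 * (sin x)\<^sup>2) * (m / 2)) (at s)"
    unfolding x_def
    by (rule DERIV_chain2[OF arctan_tan_deriv[OF k(1)]]) (auto intro!: derivative_eq_intros)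
  have C: "cos (s * m) = (cos x)\<^sup>2 - (sin x)\<^sup>2"
    using cos_double[of x] by (simp add: x_def)
  have den: "lam - cos (s * m) > 0" using lam cos_le_one[of "s*m"] by linarith
  have e: "(cos x)\<^sup>2 + k\<^sup>2 * (sin x)\<^sup>2 = (lam - cos (s * m)) / (lam - 1)"
  proof -
    have "lam - cos (s * m) = (lam - 1) * (cos x)\<^sup>2 + (lam + 1) * (sin x)\<^sup>2"
      unfolding C using sin_cos_squared_add[of x] by algebra
    moreover have "(cos x)\<^sup>2 + k\<^sup>2 * (sin x)\<^sup>2
        = ((lam - 1) * (cos x)\<^sup>2 + (lam + 1) * (sin x)\<^sup>2) / (lam - 1)"
      unfolding k(2) using lam by (simp add: add_divide_distrib[of "(lam - 1) * (cos x)\<^sup>2"])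
    ultimately show ?thesis by simp
  qed
  have km: "k * m * (lam - 1) = lam\<^sup>2 - 1"
  proof -
    have "k * m = sqrt ((lam + 1)\<^sup>2)"
      unfolding k_def m_def real_sqrt_mult[symmetric] using lam
      by (intro arg_cong[of _ _ sqrt]) (simp add: field_simps power2_eq_square)
    also have "\<dots> = lam + 1" using lam by simp
    finally show ?thesis by (simp add: algebra_simps power2_eq_square)
  qed
  have aux: "2 * (k / (D / (lam - 1)) * (m / 2)) = k * m * (lam - 1) / D" for D by simp
  have v: "2 * (k / ((cos x)\<^sup>2 + k\<^sup>2 * (sin x)\<^sup>2) * (m / 2)) = (lam\<^sup>2 - 1) / (lam - cos (s * m))"
    unfolding e km[symmetric] by (rule aux)
  have "((\<lambda>s. - lam * s + 2 * arctan_tan k (s / 2 * m)) has_real_derivative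
      (- lam + 2 * (k / ((cos x)\<^sup>2 + k\<^sup>2 * (sin x)\<^sup>2) * (m / 2)))) (at s)"
    by (intro DERIV_add DERIV_cmult DERIV_cmult_Id d)
  then show ?thesis unfolding v
    by (simp add: alpha1_def[abs_def] k_def m_def)
qed

lemma alpha3_deriv:
  assumes lam: "lam > 1"
  shows "(alpha3 lam has_real_derivative
    (sqrt (lam\<^sup>2 - 1) * sin (s * sqrt (lam\<^sup>2 - 1)) / (lam - cos (s * sqrt (lam\<^sup>2 - 1))))) (at s)"
proof -
  have den: "lam - cos x > 0" for x using lam cos_le_one[of x] by linarith
  show ?thesis unfolding alpha3_def[abs_def]
    by (auto intro!: derivative_eq_intros den)
qed

lemma has_derivative_vector3:
  fixes f g h :: "'a::real_normed_vector \<Rightarrow> real"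
  assumes "(f has_derivative f') F" "(g has_derivative g') F" "(h has_derivative h') F"
  shows "((\<lambda>p. vector [f p, g p, h p] :: real^3) has_derivative (\<lambda>w. vector [f' w, g' w, h' w])) F"
proof -
  have eq: "(vector [x, y, z] :: real^3) = x *\<^sub>R axis 1 1 + y *\<^sub>R axis 2 1 + z *\<^sub>R axis 3 1" for x y z
    by (simp add: vec_eq_iff forall_3 axis_def)
  show ?thesis unfolding eq by (intro derivative_intros assms)
qed

lemma has_derivative_of_fst:
  assumes "(g has_real_derivative g') (at s)"
  shows "((\<lambda>p::real \<times> real. g (fst p)) has_derivative (\<lambda>w. fst w * g')) (at (s, t))"
proof -
  have "(fst has_derivative fst) (at (s, t))"
    by (rule has_derivative_fst[OF has_derivative_ident])
  moreover have "(g has_derivative (\<lambda>x. x * g')) (at (fst (s, t)))"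
    using assms by (simp add: has_field_derivative_def mult.commute[of g'] cong del: if_weak_cong)
      (metis (no_types, lifting) ext mult.commute)
  ultimately show ?thesis
    by (rule has_derivative_compose)
qed

text \<open>The surface is parametrized isometrically, its Gauss map is
  \<open>(- alpha3', 0, alpha1')\<close>, and it is a translating soliton.\<close>

context
  fixes lam :: real and a b \<kappa> :: "real \<Rightarrow> real"
  assumes lam: "lam > 1"
  defines "a \<equiv> \<lambda>s. - lam + (lam\<^sup>2 - 1) / (lam - cos (s * sqrt (lam\<^sup>2 - 1)))"
    and "b \<equiv> \<lambda>s. sqrt (lam\<^sup>2 - 1) * sin (s * sqrt (lam\<^sup>2 - 1)) / (lam - cos (s * sqrt (lam\<^sup>2 - 1)))"
    and "\<kappa> \<equiv> \<lambda>s. (lam\<^sup>2 - 1) / (lam - cos (s * sqrt (lam\<^sup>2 - 1)))"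
begin

lemma soliton_cyl_partial:
  "partial_d (soliton_cyl lam) 1 (s, t) = vector [a s, 0, b s]"
  "partial_d (soliton_cyl lam) 2 (s, t) = vector [0, 1, 0]"
proof -
  have "(soliton_cyl lam has_derivative (\<lambda>w. vector [fst w * a s, snd w, fst w * b s])) (at (s, t))"
    unfolding soliton_cyl_def case_prod_beta a_def b_def
    by (intro has_derivative_vector3 has_derivative_of_fst alpha1_deriv alpha3_deriv lam
        has_derivative_snd has_derivative_ident)
  then have "frechet_derivative (soliton_cyl lam) (at (s, t))
      = (\<lambda>w. vector [fst w * a s, snd w, fst w * b s])"
    by (rule frechet_derivative_at[symmetric])
  then show "partial_d (soliton_cyl lam) 1 (s, t) = vector [a s, 0, b s]"
    "partial_d (soliton_cyl lam) 2 (s, t) = vector [0, 1, 0]"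
    by (simp_all add: partial_d_def e_par_def)
qed

lemma unit_speed: "(a s)\<^sup>2 + (b s)\<^sup>2 = 1"
proof -
  define m where "m = sqrt (lam\<^sup>2 - 1)"
  define C where "C = cos (s * m)"
  define S where "S = sin (s * m)"
  have m: "m\<^sup>2 = lam\<^sup>2 - 1" using lam by (simp add: m_def one_less_power less_imp_le)
  have SC: "S\<^sup>2 = 1 - C\<^sup>2" by (simp add: S_def C_def sin_squared_eq)
  have den: "lam - C > 0" using lam cos_le_one[of "s*m"] unfolding C_def by linarith
  have "a s = (lam * C - 1) / (lam - C)" using den
    unfolding a_def m_def[symmetric] C_def[symmetric]
    by (simp add: field_simps power2_eq_square)
  moreover have "b s = m * S / (lam - C)"
    by (simp add: b_def m_def C_def S_def)
  ultimately have "(a s)\<^sup>2 + (b s)\<^sup>2 = ((lam * C - 1)\<^sup>2 + m\<^sup>2 * S\<^sup>2) / (lam - C)\<^sup>2"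
    by (simp add: power_divide power_mult_distrib add_divide_distrib)
  also have "(lam * C - 1)\<^sup>2 + m\<^sup>2 * S\<^sup>2 = (lam - C)\<^sup>2"
    unfolding m SC by algebra
  finally show ?thesis using den by simp
qed

lemma soliton_cyl_first_form: "first_form (soliton_cyl lam) p = mat 1"
  using unit_speed[of "fst p"]
  by (cases p)
     (simp add: first_form_def mat_def vec_eq_iff forall_2 soliton_cyl_partial inner_vec_def sum_3
        power2_eq_square)

lemma soliton_cyl_gauss_map: "gauss_map (soliton_cyl lam) = (\<lambda>(s, t). vector [- b s, 0, a s])"
proof
  fix p :: "real \<times> real"
  obtain s t where p: "p = (s, t)" by (cases p)
  have c: "cross3 (vector [a s, 0, b s]) (vector [0, 1, 0]) = vector [- b s, 0, a s]"
    by (simp add: cross3_def)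
  have "norm (vector [- b s, 0, a s] :: real^3) = 1"
    using unit_speed[of s]
    by (simp add: norm_eq_sqrt_inner inner_vec_def sum_3 power2_eq_square add.commute)
  then show "gauss_map (soliton_cyl lam) p = (case p of (s, t) \<Rightarrow> vector [- b s, 0, a s])"
    by (simp add: p gauss_map_def soliton_cyl_partial c sgn_div_norm)
qed

lemma a_b_deriv:
  "(a has_real_derivative - (b s * \<kappa> s)) (at s)" "(b has_real_derivative a s * \<kappa> s) (at s)"
proof -
  have den: "lam - cos x > 0" for x using lam cos_le_one[of x] by linarith
  then have den': "lam - cos x \<noteq> 0" "lam \<noteq> cos x" for x by (smt (verit))+
  define m where "m = sqrt (lam\<^sup>2 - 1)"
  define C where "C = cos (s * m)"
  define S where "S = sin (s * m)"
  have m: "m\<^sup>2 = lam\<^sup>2 - 1" using lam by (simp add: m_def one_less_power less_imp_le)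
  have SC: "S\<^sup>2 = 1 - C\<^sup>2" by (simp add: S_def C_def sin_squared_eq)
  have dC: "lam - C \<noteq> 0" using den' by (simp add: C_def)
  show "(a has_real_derivative - (b s * \<kappa> s)) (at s)"
    unfolding a_def b_def \<kappa>_def
    by (auto intro!: derivative_eq_intros simp: den' mult_ac)
  have "(b has_real_derivative (m * (C * m) * (lam - C) - m * S * (S * m)) / ((lam - C) * (lam - C))) (at s)"
    unfolding b_def m_def[symmetric] C_def S_def
    by (auto intro!: derivative_eq_intros simp: den')
  moreover have "m * (C * m) * (lam - C) - m * S * (S * m) = m\<^sup>2 * (lam * C - C\<^sup>2 - S\<^sup>2)"
    by algebra
  moreover have "m\<^sup>2 * (lam * C - C\<^sup>2 - S\<^sup>2) = m\<^sup>2 * (lam * C - 1)"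
    unfolding SC by simp
  moreover have "a s * \<kappa> s = m\<^sup>2 * (lam * C - 1) / ((lam - C) * (lam - C))"
  proof -
    have "a s = (lam * C - 1) / (lam - C)" using dC
      unfolding a_def m_def[symmetric] C_def[symmetric]
      by (simp add: field_simps power2_eq_square)
    moreover have "\<kappa> s = m\<^sup>2 / (lam - C)"
      unfolding \<kappa>_def m m_def[symmetric] C_def[symmetric] by simp
    ultimately show ?thesis by simp
  qed
  ultimately show "(b has_real_derivative a s * \<kappa> s) (at s)" by simp
qed

lemma soliton_cyl_shape_op:
  "shape_op (soliton_cyl lam) (s, t) = (\<chi> i j. if i = 1 \<and> j = 1 then \<kappa> s else 0)"
proof -
  have "(gauss_map (soliton_cyl lam) has_derivative
      (\<lambda>w. vector [- (fst w * (a s * \<kappa> s)), 0, fst w * (- (b s * \<kappa> s))])) (at (s, t))"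
    unfolding soliton_cyl_gauss_map case_prod_beta
    by (intro has_derivative_vector3 has_derivative_minus has_derivative_of_fst a_b_deriv has_derivative_const)
  then have "frechet_derivative (gauss_map (soliton_cyl lam)) (at (s, t))
      = (\<lambda>w. vector [- (fst w * (a s * \<kappa> s)), 0, fst w * (- (b s * \<kappa> s))])"
    by (rule frechet_derivative_at[symmetric])
  then have p: "partial_d (gauss_map (soliton_cyl lam)) 1 (s, t)
      = vector [- (a s * \<kappa> s), 0, - (b s * \<kappa> s)]"
    "partial_d (gauss_map (soliton_cyl lam)) 2 (s, t) = vector [0, 0, 0]"
    by (simp_all add: partial_d_def e_par_def)
  have "a s * \<kappa> s * a s + b s * \<kappa> s * b s = ((a s)\<^sup>2 + (b s)\<^sup>2) * \<kappa> s"
    by algebra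
  then have k: "a s * \<kappa> s * a s + b s * \<kappa> s * b s = \<kappa> s"
    by (simp add: unit_speed)
  have inv: "matrix_inv (mat 1 :: real^2^2) = mat 1"
    unfolding matrix_inv_def by (rule some_equality) (auto simp: matrix_mul_lid matrix_mul_rid)
  have "second_form (soliton_cyl lam) (s, t) = (\<chi> i j. if i = 1 \<and> j = 1 then \<kappa> s else 0)"
    using k by (simp add: vec_eq_iff forall_2 second_form_def p soliton_cyl_partial inner_vec_def sum_3)
  then show ?thesis
    unfolding shape_op_def soliton_cyl_first_form inv by (simp add: matrix_mul_lid)
qed

lemma soliton_cyl_translating_soliton:
  "mean_curv (soliton_cyl lam) p = gauss_map (soliton_cyl lam) p \<bullet> vector [0, 0, 1] + lam"
  by (cases p) (simp add: mean_curv_def soliton_cyl_shape_op trace_def sum_2 soliton_cyl_gauss_map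
      inner_vec_def sum_3 a_def \<kappa>_def)

end

end

theory Submission
  imports Defs
begin

text \<open>
  Write \<open>m = sqrt (lam\<^sup>2 - 1)\<close> and \<open>W s = lam - cos (m s)\<close>, so that the density on the surface is \<open>W\<close>,
  the induced metric is flat and \<open>|A| = m\<^sup>2 / W\<close>. The surface is unstable because a product
  \<open>u (s, t) = f s * sin (2 \<pi> t / L)\<close> violates the stability inequality. The sine factor makes the weighted
  mean of \<open>u\<close> vanish whatever \<open>f\<close> is, and since \<open>sin\<^sup>2\<close> and \<open>cos\<^sup>2\<close> both have integral \<open>L / 2\<close>, the
  second variation separates:
  \<open>Q u = L / 2 * (\<integral> (W f'\<^sup>2 - m\<^sup>4 f\<^sup>2 / W) ds + (2 \<pi> / L)\<^sup>2 * \<integral> W f\<^sup>2 ds)\<close>.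

  The profile \<open>f\<close> is found by passing to the tangent angle \<open>\<theta>\<close> of the curve. Since
  \<open>\<theta>' = m\<^sup>2 / W\<close>, the first integral becomes \<open>m\<^sup>2 * \<integral> ((df/d\<theta>)\<^sup>2 - f\<^sup>2) d\<theta>\<close>, over an interval of length
  \<open>2 \<pi>\<close> because the tangent turns once per period. There the first Dirichlet eigenfunction is
  \<open>sin ((\<theta> - \<theta>0) / 2)\<close>, with \<open>\<theta>0\<close> the angle at the left end, and it makes the integral negative:
  \<open>(df/d\<theta>)\<^sup>2\<close> contributes only a quarter of what \<open>f\<^sup>2\<close> does.
  The half-angle formulas turn this eigenfunction, up to a constant factor, into the elementary
  function \<open>f s = cos (m (s - \<sigma>) / 2) / sqrt (W s)\<close>. For it the first integral is
  \<open>- 3/4 \<pi> (lam + cos (m \<sigma>))\<close> (\<open>profile_curve_energy_integral\<close>), while \<open>W f\<^sup>2\<close> is just a squared cosine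
  with integral \<open>\<pi> / m\<close> (\<open>profile_weighted_L2_integral\<close>). Hence \<open>Q u\<close> is negative
  (\<open>second_variation_test_fun\<close>) exactly when \<open>(2 \<pi> / L)\<^sup>2 < 3/4 m (lam + cos (m \<sigma>))\<close>,
  and \<open>L0\<close> is the length at which both sides agree.
\<close>

section \<open>Smooth functions\<close>

text \<open>Smoothness of every order in one stroke: all iterated directional derivatives stay in the class,
  hence are differentiable.\<close>

lemma Ck_on_closed_class:
  assumes deriv: "\<And>f. P f \<Longrightarrow> \<exists>D. \<forall>x. (f has_derivative (\<lambda>v. D v x)) (at x) \<and> (\<forall>v. P (D v))"
    and f: "P f"
  shows "Ck_on k U f"
  using f
proof (induction k arbitrary: f)
  case 0
  from deriv[OF this] have "\<And>x. f differentiable (at x)"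
    by (auto simp: differentiable_def)
  then show ?case
    by (simp add: differentiable_imp_continuous_on differentiable_on_def differentiable_at_withinI)
next
  case (Suc k)
  from deriv[OF Suc.prems] obtain D
    where D: "\<And>x. (f has_derivative (\<lambda>v. D v x)) (at x)" "\<And>v. P (D v)"
    by blast
  have "frechet_derivative f (at x) = (\<lambda>v. D v x)" for x
    using frechet_derivative_at[OF D(1)] by simp
  then show ?case
    using D Suc.IH by (auto simp: differentiable_def)
qed

text \<open>A class of functions closed under directional derivatives. Reciprocal square roots serve as
  a generator because their derivative \<open>- r\<^sup>3 f' / 2\<close>, with \<open>r = 1 / sqrt f\<close>, is polynomial in
  \<open>r\<close> and \<open>f'\<close>; with square roots and quotients, two generators would have to be carried along.\<close>

inductive elem_fun :: "('a::real_normed_vector \<Rightarrow> real) \<Rightarrow> bool" where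
  const: "elem_fun (\<lambda>_. c)"
| linear: "bounded_linear f \<Longrightarrow> elem_fun f"
| add: "elem_fun f \<Longrightarrow> elem_fun g \<Longrightarrow> elem_fun (\<lambda>x. f x + g x)"
| mult: "elem_fun f \<Longrightarrow> elem_fun g \<Longrightarrow> elem_fun (\<lambda>x. f x * g x)"
| sin: "elem_fun f \<Longrightarrow> elem_fun (\<lambda>x. sin (f x))"
| cos: "elem_fun f \<Longrightarrow> elem_fun (\<lambda>x. cos (f x))"
| inverse_sqrt: "elem_fun f \<Longrightarrow> (\<And>x. 0 < f x) \<Longrightarrow> elem_fun (\<lambda>x. inverse (sqrt (f x)))"

lemma inverse_sqrt_deriv:
  assumes "0 < x"
  shows "((\<lambda>x. inverse (sqrt x)) has_real_derivative - (inverse (sqrt x) ^ 3) / 2) (at x)"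
  using assms
  by (auto intro!: derivative_eq_intros simp: field_simps power3_eq_cube)

lemma elem_fun_deriv:
  assumes "elem_fun f"
  shows "\<exists>D. \<forall>x. (f has_derivative (\<lambda>v. D v x)) (at x) \<and> (\<forall>v. elem_fun (D v))"
  using assms
proof induction
  case (const c)
  show ?case
    by (rule exI[of _ "\<lambda>v x. 0"]) (auto intro: elem_fun.const)
next
  case (linear f)
  then show ?case
    by (intro exI[of _ "\<lambda>v x. f v"])
      (auto intro: elem_fun.const bounded_linear.has_derivative[OF _ has_derivative_ident])
next
  case (add f g)
  then obtain D E where D: "\<And>x. (f has_derivative (\<lambda>v. D v x)) (at x)" "\<And>v. elem_fun (D v)"
    and E: "\<And>x. (g has_derivative (\<lambda>v. E v x)) (at x)" "\<And>v. elem_fun (E v)"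
    by blast
  show ?case
    by (intro exI[of _ "\<lambda>v x. D v x + E v x"])
      (auto intro!: elem_fun.add D E has_derivative_add)
next
  case (mult f g)
  then obtain D E where D: "\<And>x. (f has_derivative (\<lambda>v. D v x)) (at x)" "\<And>v. elem_fun (D v)"
    and E: "\<And>x. (g has_derivative (\<lambda>v. E v x)) (at x)" "\<And>v. elem_fun (E v)"
    by blast
  show ?case
    by (intro exI[of _ "\<lambda>v x. f x * E v x + D v x * g x"])
      (auto intro!: elem_fun.add elem_fun.mult D E mult.hyps has_derivative_mult)
next
  case (sin f)
  then obtain D where D: "\<And>x. (f has_derivative (\<lambda>v. D v x)) (at x)" "\<And>v. elem_fun (D v)"
    by blast
  show ?case
    by (intro exI[of _ "\<lambda>v x. D v x * cos (f x)"])
      (auto intro!: elem_fun.mult elem_fun.cos D sin.hyps has_derivative_sin)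
next
  case (cos f)
  then obtain D where D: "\<And>x. (f has_derivative (\<lambda>v. D v x)) (at x)" "\<And>v. elem_fun (D v)"
    by blast
  have "((\<lambda>x. cos (f x)) has_derivative (\<lambda>v. D v x * (- 1 * sin (f x)))) (at x)" for x
    using has_derivative_cos[OF D(1)] by simp
  then show ?case
    by (intro exI[of _ "\<lambda>v x. D v x * (- 1 * sin (f x))"] allI conjI)
      (assumption | rule elem_fun.mult elem_fun.const elem_fun.sin D cos.hyps)+
next
  case (inverse_sqrt f)
  then obtain D where D: "\<And>x. (f has_derivative (\<lambda>v. D v x)) (at x)" "\<And>v. elem_fun (D v)"
    by blast
  define r where "r = (\<lambda>x. inverse (sqrt (f x)))"
  have r: "elem_fun r"
    unfolding r_def using inverse_sqrt.hyps by (rule elem_fun.inverse_sqrt)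
  have "(r has_derivative (\<lambda>v. (- (1/2)) * (r x * (r x * (r x * D v x))))) (at x)" for x
  proof -
    have "(r has_derivative (\<lambda>v. - (inverse (sqrt (f x)) ^ 3) / 2 * D v x)) (at x)"
      unfolding r_def
      using has_derivative_compose[OF D(1) inverse_sqrt_deriv[OF inverse_sqrt.hyps(2), of x,
            unfolded has_field_derivative_def]] by simp
    then show ?thesis by (simp add: r_def power3_eq_cube mult_ac)
  qed
  then show ?case
    unfolding r_def[symmetric]
    by (intro exI[of _ "\<lambda>v x. (- (1/2)) * (r x * (r x * (r x * D v x)))"] allI conjI)
      (assumption | rule elem_fun.mult elem_fun.const r D)+
qed

lemma elem_fun_smooth_near: "elem_fun f \<Longrightarrow> smooth_near K f"
  unfolding smooth_near_def
  by (rule exI[of _ UNIV]) (auto intro: Ck_on_closed_class[of elem_fun] elem_fun_deriv)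

section \<open>Integrals over rectangles\<close>

lemma has_integral_product:
  fixes f g :: "real \<Rightarrow> real"
  assumes f: "continuous_on {a..b} f" "(f has_integral i) {a..b}"
    and g: "continuous_on {c..d} g" "(g has_integral j) {c..d}"
  shows "((\<lambda>p. f (fst p) * g (snd p)) has_integral i * j) ({a..b} \<times> {c..d})"
proof -
  define F where "F = (\<lambda>p::real \<times> real. f (fst p) * g (snd p))"
  have K: "{a..b} \<times> {c..d} = cbox (a, c) (b, d)"
    by (simp add: cbox_Pair_eq)
  have cont: "continuous_on (cbox (a, c) (b, d)) F"
    unfolding F_def K[symmetric]
    by (intro continuous_on_mult continuous_on_compose2[OF f(1)] continuous_on_compose2[OF g(1)]
        continuous_intros) auto
  have "integral (cbox (a, c) (b, d)) F = integral {a..b} (\<lambda>x. f x * j)"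
    using integral_prod_continuous[OF cont] g(2)
    by (simp add: F_def integral_unique)
  also have "\<dots> = i * j"
    using f(2) by (simp add: integral_unique)
  finally show ?thesis
    unfolding F_def[symmetric] K using integrable_integral[OF integrable_continuous[OF cont]] by simp
qed

lemma has_integral_cos_sq:
  fixes a b k e :: real
  assumes "a \<le> b" "k \<noteq> 0"
  shows "((\<lambda>x. (cos (k * x + e))\<^sup>2) has_integral
    ((b - a) / 2 + (sin (2 * (k * b + e)) - sin (2 * (k * a + e))) / (4 * k))) {a..b}"
proof -
  define F where "F = (\<lambda>x. x / 2 + sin (2 * (k * x + e)) / (4 * k))"
  have "(F has_real_derivative (cos (k * x + e))\<^sup>2) (at x)" for x
  proof -
    have "(F has_real_derivative 1 / 2 + cos (2 * (k * x + e)) * (2 * k) / (4 * k)) (at x)"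
      unfolding F_def using assms(2) by (auto intro!: derivative_eq_intros)
    moreover have "1 / 2 + cos (2 * (k * x + e)) * (2 * k) / (4 * k) = (cos (k * x + e))\<^sup>2"
      unfolding cos_double_cos using assms(2) by (simp add: field_simps)
    ultimately show ?thesis by simp
  qed
  then have "((\<lambda>x. (cos (k * x + e))\<^sup>2) has_integral (F b - F a)) {a..b}"
    using assms(1)
    by (intro fundamental_theorem_of_calculus)
      (auto simp: has_real_derivative_iff_has_vector_derivative[symmetric]
        intro: has_field_derivative_at_within)
  moreover have "F b - F a = (b - a) / 2 + (sin (2 * (k * b + e)) - sin (2 * (k * a + e))) / (4 * k)"
    using assms(2) by (simp add: F_def field_simps)
  ultimately show ?thesis by simp
qed

section \<open>The weighted geometry of the cylinder\<close>

definition freq :: "real \<Rightarrow> real" where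
  "freq lam = sqrt (lam\<^sup>2 - 1)"

definition weight :: "real \<Rightarrow> real \<Rightarrow> real" where
  "weight lam s = lam - cos (s * freq lam)"

lemma freq_pos: "lam > 1 \<Longrightarrow> freq lam > 0"
  by (simp add: freq_def one_less_power)

lemma freq_sq: "lam > 1 \<Longrightarrow> (freq lam)\<^sup>2 = lam\<^sup>2 - 1"
  by (simp add: freq_def one_less_power less_imp_le)

lemma weight_pos: "lam > 1 \<Longrightarrow> weight lam s > 0"
  using cos_le_one[of "s * freq lam"] unfolding weight_def by linarith

lemma weight_deriv: "(weight lam has_real_derivative freq lam * sin (s * freq lam)) (at s)"
  unfolding weight_def[abs_def] by (auto intro!: derivative_eq_intros)

lemma weighted_integral_soliton_cyl:
  assumes "lam > 1"
  shows "weighted_integral (vector [0, 0, 1]) (soliton_cyl lam) K f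
    = integral K (\<lambda>p. f p * weight lam (fst p))"
proof -
  have "soliton_cyl lam p \<bullet> vector [0, 0, 1] = ln (weight lam (fst p))" for p
    by (cases p) (simp add: soliton_cyl_def inner_vec_def sum_3 alpha3_def weight_def freq_def)
  then show ?thesis
    using weight_pos[OF assms]
    by (simp add: weighted_integral_def soliton_cyl_first_form[OF assms])
qed

lemma norm_surf_grad_soliton_cyl:
  assumes "lam > 1"
  shows "(norm (surf_grad (soliton_cyl lam) u p))\<^sup>2 = (partial_d u 1 p)\<^sup>2 + (partial_d u 2 p)\<^sup>2"
proof -
  obtain s t where p: "p = (s, t)" by (cases p)
  define a where "a = - lam + (lam\<^sup>2 - 1) / (lam - cos (s * sqrt (lam\<^sup>2 - 1)))"
  define b where "b = sqrt (lam\<^sup>2 - 1) * sin (s * sqrt (lam\<^sup>2 - 1)) / (lam - cos (s * sqrt (lam\<^sup>2 - 1)))"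
  have ab: "a\<^sup>2 + b\<^sup>2 = 1"
    unfolding a_def b_def by (rule unit_speed[OF assms])
  have inv: "matrix_inv (mat 1 :: real^2^2) = mat 1"
    unfolding matrix_inv_def by (rule some_equality) (auto simp: matrix_mul_lid matrix_mul_rid)
  have "surf_grad (soliton_cyl lam) u p
      = partial_d u 1 p *\<^sub>R vector [a, 0, b] + partial_d u 2 p *\<^sub>R vector [0, 1, 0]"
    by (simp add: surf_grad_def soliton_cyl_first_form[OF assms] inv sum_2 p
        soliton_cyl_partial[OF assms] a_def b_def)
  then have "(norm (surf_grad (soliton_cyl lam) u p))\<^sup>2
      = (partial_d u 1 p)\<^sup>2 * (a\<^sup>2 + b\<^sup>2) + (partial_d u 2 p)\<^sup>2"
    unfolding power2_norm_eq_inner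
    by (simp add: inner_vec_def sum_3 algebra_simps power2_eq_square)
  then show ?thesis by (simp add: ab)
qed

lemma norm_A_sq_soliton_cyl:
  assumes "lam > 1"
  shows "norm_A_sq (soliton_cyl lam) p = ((freq lam)\<^sup>2 / weight lam (fst p))\<^sup>2"
  unfolding freq_sq[OF assms] unfolding weight_def freq_def
  by (cases p) (simp add: norm_A_sq_def soliton_cyl_shape_op[OF assms] trace_def
      matrix_matrix_mult_def sum_2 power2_eq_square)

lemma partial_d_product:
  assumes f: "(f has_real_derivative f') (at s)" and g: "(g has_real_derivative g') (at t)"
  shows "partial_d (\<lambda>p. f (fst p) * g (snd p)) 1 (s, t) = f' * g t"
    and "partial_d (\<lambda>p. f (fst p) * g (snd p)) 2 (s, t) = f s * g'"
proof -
  have F: "((\<lambda>p::real \<times> real. f (fst p)) has_derivative (\<lambda>v. f' * fst v)) (at (s, t))"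
    by (rule has_derivative_compose[where s = UNIV and g = f and f = fst and x = "(s, t)" and g' = "\<lambda>x. f' * x",
          OF has_derivative_fst[OF has_derivative_ident]])
      (use f in \<open>simp add: has_field_derivative_def\<close>)
  have G: "((\<lambda>p::real \<times> real. g (snd p)) has_derivative (\<lambda>v. g' * snd v)) (at (s, t))"
    by (rule has_derivative_compose[where s = UNIV and g = g and f = snd and x = "(s, t)" and g' = "\<lambda>x. g' * x",
          OF has_derivative_snd[OF has_derivative_ident]])
      (use g in \<open>simp add: has_field_derivative_def\<close>)
  have "frechet_derivative (\<lambda>p. f (fst p) * g (snd p)) (at (s, t))
      = (\<lambda>v. f s * (g' * snd v) + f' * fst v * g t)"
    using frechet_derivative_at[OF has_derivative_mult[OF F G]] by simp
  then show "partial_d (\<lambda>p. f (fst p) * g (snd p)) 1 (s, t) = f' * g t"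
    "partial_d (\<lambda>p. f (fst p) * g (snd p)) 2 (s, t) = f s * g'"
    by (simp_all add: partial_d_def e_par_def)
qed

section \<open>The profile of the test function\<close>

definition profile :: "real \<Rightarrow> real \<Rightarrow> real \<Rightarrow> real" where
  "profile lam \<sigma> s = cos ((s - \<sigma>) * freq lam / 2) * inverse (sqrt (weight lam s))"

definition coprofile :: "real \<Rightarrow> real \<Rightarrow> real \<Rightarrow> real" where
  "coprofile lam \<sigma> s = - freq lam *
     (lam * sin ((s - \<sigma>) * freq lam / 2) + sin ((s + \<sigma>) * freq lam / 2))
     * inverse (sqrt (weight lam s))"

text \<open>With \<open>\<phi> = \<theta> - \<theta>0\<close> the angle turned by the tangent since the left end,
  \<open>profile\<close> is \<open>c * sin (\<phi> / 2)\<close> and \<open>coprofile\<close> is \<open>m\<^sup>2 c * cos (\<phi> / 2)\<close>, where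
  \<open>c = sqrt (lam + cos (m \<sigma>)) / m\<close>. Since \<open>\<phi>' = m\<^sup>2 / W\<close>, each derivative is a multiple
  of the other function, and Pythagoras gives \<open>profile_energy\<close>. In the proofs the identities are
  checked directly, with \<open>y\<close> and \<open>z\<close> chosen such that \<open>y + z = m s\<close> and \<open>z - y = m \<sigma>\<close>.\<close>

lemma profile_deriv:
  assumes "lam > 1"
  shows "(profile lam \<sigma> has_real_derivative coprofile lam \<sigma> s / (2 * weight lam s)) (at s)"
proof -
  define m where "m = freq lam"
  define y where "y = (s - \<sigma>) * m / 2"
  define z where "z = (s + \<sigma>) * m / 2"
  define W where "W = weight lam s"
  define r where "r = inverse (sqrt W)"
  have W: "W > 0" using weight_pos[OF assms] by (simp add: W_def)
  have yz: "s * m = y + z" by (simp add: y_def z_def field_simps)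
  have Wyz: "W = lam - cos (y + z)" by (simp add: W_def weight_def m_def[symmetric] yz)
  have r: "r\<^sup>2 = 1 / W" using W by (simp add: r_def power_inverse divide_inverse)
  have dr: "((\<lambda>s. inverse (sqrt (weight lam s))) has_real_derivative
      - (r ^ 3) / 2 * (m * sin (y + z))) (at s)"
    using DERIV_chain2[OF inverse_sqrt_deriv[OF W[unfolded W_def]] weight_deriv]
    by (simp add: r_def W_def m_def yz[unfolded m_def])
  have dc: "((\<lambda>s. cos ((s - \<sigma>) * m / 2)) has_real_derivative - (m / 2) * sin y) (at s)"
    by (auto intro!: derivative_eq_intros simp: y_def)
  have "(profile lam \<sigma> has_real_derivative
      - (m / 2) * sin y * r + - (r ^ 3) / 2 * (m * sin (y + z)) * cos y) (at s)"
    using DERIV_mult[OF dc dr]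
    by (simp add: profile_def[abs_def] m_def r_def W_def y_def)
  moreover have "- (m / 2) * sin y * r + - (r ^ 3) / 2 * (m * sin (y + z)) * cos y
      = - m * (lam * sin y + sin z) * r / (2 * W)"
  proof -
    have id: "sin y * W + cos y * sin (y + z) = lam * sin y + sin z"
      using sin_diff[of "y + z" y] by (simp add: Wyz algebra_simps)
    have "r ^ 3 = r / W" using r by (simp add: power3_eq_cube power2_eq_square)
    then have "- (m / 2) * sin y * r + - (r ^ 3) / 2 * (m * sin (y + z)) * cos y
        = - m * (sin y * W + cos y * sin (y + z)) * r / (2 * W)"
      using W by (simp add: field_simps)
    then show ?thesis unfolding id .
  qed
  ultimately show ?thesis
    by (simp add: coprofile_def m_def r_def W_def y_def z_def)
qed

lemma coprofile_deriv:
  assumes "lam > 1"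
  shows "(coprofile lam \<sigma> has_real_derivative
    - ((freq lam) ^ 4 * profile lam \<sigma> s / (2 * weight lam s))) (at s)"
proof -
  define m where "m = freq lam"
  define y where "y = (s - \<sigma>) * m / 2"
  define z where "z = (s + \<sigma>) * m / 2"
  define W where "W = weight lam s"
  define r where "r = inverse (sqrt W)"
  have W: "W > 0" using weight_pos[OF assms] by (simp add: W_def)
  have m: "m\<^sup>2 = lam\<^sup>2 - 1" using freq_sq[OF assms] by (simp add: m_def)
  have yz: "s * m = y + z" by (simp add: y_def z_def field_simps)
  have Wyz: "W = lam - cos (y + z)" by (simp add: W_def weight_def m_def[symmetric] yz)
  have r: "r\<^sup>2 = 1 / W" using W by (simp add: r_def power_inverse divide_inverse)
  have dr: "((\<lambda>s. inverse (sqrt (weight lam s))) has_real_derivative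
      - (r ^ 3) / 2 * (m * sin (y + z))) (at s)"
    using DERIV_chain2[OF inverse_sqrt_deriv[OF W[unfolded W_def]] weight_deriv]
    by (simp add: r_def W_def m_def yz[unfolded m_def])
  have dc: "((\<lambda>s. - m * (lam * sin ((s - \<sigma>) * m / 2) + sin ((s + \<sigma>) * m / 2))) has_real_derivative
      - m * (lam * ((m / 2) * cos y) + (m / 2) * cos z)) (at s)"
    by (auto intro!: derivative_eq_intros simp: y_def z_def mult_ac)
  have "(coprofile lam \<sigma> has_real_derivative
      - m * (lam * ((m / 2) * cos y) + (m / 2) * cos z) * r
      + - (r ^ 3) / 2 * (m * sin (y + z)) * (- m * (lam * sin y + sin z))) (at s)"
    using DERIV_mult[OF dc dr]
    by (simp add: coprofile_def[abs_def] m_def r_def W_def y_def z_def)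
  moreover have "- m * (lam * ((m / 2) * cos y) + (m / 2) * cos z) * r
      + - (r ^ 3) / 2 * (m * sin (y + z)) * (- m * (lam * sin y + sin z))
      = - (m ^ 4 * (cos y * r) / (2 * W))"
  proof -
    have c1: "cos (y + z) * cos y + sin (y + z) * sin y = cos z"
      using cos_diff[of "y + z" y] by simp
    have c2: "cos (y + z) * cos z + sin (y + z) * sin z = cos y"
      using cos_diff[of "y + z" z] by simp
    have id: "(lam * cos y + cos z) * W - (lam * sin y + sin z) * sin (y + z) = m\<^sup>2 * cos y"
    proof -
      have "(lam * cos y + cos z) * W - (lam * sin y + sin z) * sin (y + z)
          = lam\<^sup>2 * cos y + lam * cos z
            - lam * (cos (y + z) * cos y + sin (y + z) * sin y)
            - (cos (y + z) * cos z + sin (y + z) * sin z)"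
        unfolding Wyz by (simp add: algebra_simps power2_eq_square)
      then show ?thesis unfolding c1 c2 m by (simp add: algebra_simps)
    qed
    have r3: "r ^ 3 = r / W" using r by (simp add: power3_eq_cube power2_eq_square)
    have "- m * (lam * ((m / 2) * cos y) + (m / 2) * cos z) * r
        + - (r ^ 3) / 2 * (m * sin (y + z)) * (- m * (lam * sin y + sin z))
        = - (m\<^sup>2 * ((lam * cos y + cos z) * W - (lam * sin y + sin z) * sin (y + z)) * r / (2 * W))"
      unfolding r3 using W by (simp add: field_simps power2_eq_square)
    then show ?thesis unfolding id by (simp add: power2_eq_square power4_eq_xxxx mult_ac)
  qed
  ultimately show ?thesis
    by (simp add: m_def r_def W_def y_def profile_def)
qed

lemma profile_energy:
  assumes "lam > 1"
  shows "(coprofile lam \<sigma> s)\<^sup>2 + (freq lam) ^ 4 * (profile lam \<sigma> s)\<^sup>2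
    = (lam + cos (\<sigma> * freq lam)) * (freq lam)\<^sup>2"
proof -
  define m where "m = freq lam"
  define y where "y = (s - \<sigma>) * m / 2"
  define z where "z = (s + \<sigma>) * m / 2"
  define W where "W = weight lam s"
  define r where "r = inverse (sqrt W)"
  have W: "W > 0" using weight_pos[OF assms] by (simp add: W_def)
  have m: "m\<^sup>2 = lam\<^sup>2 - 1" using freq_sq[OF assms] by (simp add: m_def)
  have yz: "s * m = y + z" "\<sigma> * m = z - y" by (simp_all add: y_def z_def field_simps)
  have Wyz: "W = lam - cos (y + z)" by (simp add: W_def weight_def m_def[symmetric] yz)
  have r: "r\<^sup>2 = 1 / W" using W by (simp add: r_def power_inverse divide_inverse)
  have id: "(lam * sin y + sin z)\<^sup>2 + m\<^sup>2 * (cos y)\<^sup>2 = (lam + cos (z - y)) * W"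
  proof -
    have "(cos y * cos z)\<^sup>2 - (sin y * sin z)\<^sup>2 = (cos y)\<^sup>2 - (sin z)\<^sup>2"
      by (simp add: power_mult_distrib sin_squared_eq algebra_simps)
    moreover have "(lam * sin y + sin z)\<^sup>2 + (lam\<^sup>2 - 1) * (cos y)\<^sup>2
        = lam\<^sup>2 * ((sin y)\<^sup>2 + (cos y)\<^sup>2) + 2 * lam * (sin y * sin z)
          - ((cos y)\<^sup>2 - (sin z)\<^sup>2)"
      by (simp add: algebra_simps power2_eq_square del: sin_cos_squared_add sin_cos_squared_add3)
    moreover have "(lam + (cos z * cos y + sin z * sin y)) * (lam - (cos y * cos z - sin y * sin z))
        = lam\<^sup>2 + 2 * lam * (sin y * sin z) - ((cos y * cos z)\<^sup>2 - (sin y * sin z)\<^sup>2)"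
      by (simp add: algebra_simps power2_eq_square)
    ultimately show ?thesis
      unfolding Wyz m cos_diff cos_add by simp
  qed
  have "(coprofile lam \<sigma> s)\<^sup>2 + m ^ 4 * (profile lam \<sigma> s)\<^sup>2
      = m\<^sup>2 * ((lam * sin y + sin z)\<^sup>2 + m\<^sup>2 * (cos y)\<^sup>2) * r\<^sup>2"
    unfolding coprofile_def profile_def m_def[symmetric] W_def[symmetric] r_def[symmetric]
      y_def[symmetric] z_def[symmetric]
    by (simp add: power_mult_distrib algebra_simps power4_eq_xxxx power2_eq_square)
  also have "\<dots> = (lam + cos (\<sigma> * m)) * m\<^sup>2"
    unfolding id r yz using W by simp
  finally show ?thesis by (simp add: m_def)
qed

lemma arctan_tan_add_pi: "k > 0 \<Longrightarrow> arctan_tan k (x + pi) = arctan_tan k x + pi"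
  by (simp add: arctan_tan_eq)

text \<open>\<open>alpha1 lam s + lam * s\<close> is the tangent angle, as its derivative is the curvature
  \<open>m\<^sup>2 / W\<close>; over one period the tangent makes a full turn.\<close>

lemma alpha1_add_period:
  assumes "lam > 1" and "s' = s + 2 * pi / freq lam"
  shows "alpha1 lam s' + lam * s' = alpha1 lam s + lam * s + 2 * pi"
proof -
  have k: "sqrt ((lam + 1) / (lam - 1)) > 0" using assms by simp
  have "s' / 2 * freq lam = s / 2 * freq lam + pi"
    using freq_pos[OF assms(1)] by (simp add: assms(2) field_simps)
  then show ?thesis
    unfolding alpha1_def freq_def[symmetric] by (simp only: arctan_tan_add_pi[OF k]) simp
qed

lemma profile_endpoints:
  assumes "lam > 1"
  shows "profile lam \<sigma> (\<sigma> - pi / freq lam) = 0" "profile lam \<sigma> (\<sigma> + pi / freq lam) = 0"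
  using freq_pos[OF assms] by (simp_all add: profile_def)

text \<open>In terms of the angle \<open>\<phi>\<close> the integrand is
  \<open>(lam + cos (m \<sigma>)) (cos\<^sup>2 (\<phi>/2) / 4 - sin\<^sup>2 (\<phi>/2)) \<phi>'\<close>, that is
  \<open>(lam + cos (m \<sigma>)) (5/8 cos \<phi> - 3/8) \<phi>'\<close>. The antiderivative of the first part is a multiple of
  \<open>sin \<phi>\<close>, hence of \<open>profile * coprofile\<close>, which vanishes at both ends; the second part contributes
  a full turn of the angle.\<close>

lemma profile_curve_energy_integral:
  fixes lam \<sigma> :: real
  assumes "lam > 1"
  defines "a \<equiv> \<sigma> - pi / freq lam" and "b \<equiv> \<sigma> + pi / freq lam"
  shows "((\<lambda>s. (coprofile lam \<sigma> s)\<^sup>2 / (4 * weight lam s)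
        - (freq lam) ^ 4 * (profile lam \<sigma> s)\<^sup>2 / weight lam s)
      has_integral - (3 / 4) * pi * (lam + cos (\<sigma> * freq lam))) {a..b}"
    (is "(?q has_integral _) _")
proof -
  define d where "d = lam + cos (\<sigma> * freq lam)"
  define F where "F = (\<lambda>s. 5 / 4 * (profile lam \<sigma> s * coprofile lam \<sigma> s)
    - 3 / 8 * d * (alpha1 lam s + lam * s))"
  \<comment> \<open>\<open>3 / 8\<close> of the energy identity is subtracted: it moves the coefficients \<open>\<plusminus> 5 / 8\<close> of
    \<open>h\<^sup>2 / W\<close> and \<open>m\<^sup>4 f\<^sup>2 / W\<close> to the required \<open>1 / 4\<close> and \<open>- 1\<close>.\<close>
  have F': "(F has_real_derivative ?q s) (at s)" for s
  proof -
    define W where "W = weight lam s"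
    define f where "f = profile lam \<sigma> s"
    define h where "h = coprofile lam \<sigma> s"
    have W: "W > 0" using weight_pos[OF assms(1)] by (simp add: W_def)
    have "(alpha1 lam has_real_derivative - lam + (freq lam)\<^sup>2 / W) (at s)"
      using alpha1_deriv[OF assms(1), of s]
      by (simp add: freq_sq[OF assms(1)] W_def weight_def) (simp add: freq_def)
    then have "((\<lambda>s. alpha1 lam s + lam * s) has_real_derivative (freq lam)\<^sup>2 / W) (at s)"
      by (auto intro!: derivative_eq_intros)
    then have "(F has_real_derivative
        5 / 4 * (h / (2 * W) * h + - ((freq lam) ^ 4 * f / (2 * W)) * f)
        - 3 / 8 * d * ((freq lam)\<^sup>2 / W)) (at s)"
      unfolding F_def f_def h_def W_def
      by (intro DERIV_diff DERIV_cmult DERIV_mult profile_deriv coprofile_deriv assms)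
    moreover have "5 / 4 * (h / (2 * W) * h + - ((freq lam) ^ 4 * f / (2 * W)) * f)
        - 3 / 8 * d * ((freq lam)\<^sup>2 / W) = h\<^sup>2 / (4 * W) - (freq lam) ^ 4 * f\<^sup>2 / W"
    proof -
      have e: "d * (freq lam)\<^sup>2 = h\<^sup>2 + (freq lam) ^ 4 * f\<^sup>2"
        unfolding d_def h_def f_def by (rule profile_energy[OF assms(1), symmetric])
      have "3 / 8 * d * ((freq lam)\<^sup>2 / W) = 3 / 8 * ((d * (freq lam)\<^sup>2) / W)" by simp
      then show ?thesis
        unfolding e using W by (simp add: field_simps power2_eq_square)
    qed
    ultimately show ?thesis by (simp add: f_def h_def W_def)
  qed
  have "a \<le> b" using freq_pos[OF assms(1)] by (simp add: a_def b_def)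
  then have int: "(?q has_integral (F b - F a)) {a..b}"
    by (intro fundamental_theorem_of_calculus)
      (auto simp: has_real_derivative_iff_has_vector_derivative[symmetric]
        intro: has_field_derivative_at_within F')
  have "alpha1 lam b + lam * b = alpha1 lam a + lam * a + 2 * pi"
    by (rule alpha1_add_period[OF assms(1)]) (simp add: a_def b_def)
  moreover have "F a = - (3 / 8) * d * (alpha1 lam a + lam * a)"
    "F b = - (3 / 8) * d * (alpha1 lam b + lam * b)"
    using profile_endpoints[OF assms(1), of \<sigma>]
    by (simp_all add: F_def a_def[symmetric] b_def[symmetric])
  ultimately have "F b - F a = - (3 / 4) * pi * d"
    by (simp only:) (simp add: field_simps)
  with int show ?thesis by (simp add: d_def)
qed

lemma profile_weighted_L2_integral:
  assumes "lam > 1"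
  shows "((\<lambda>s. weight lam s * (profile lam \<sigma> s)\<^sup>2) has_integral pi / freq lam)
    {\<sigma> - pi / freq lam .. \<sigma> + pi / freq lam}"
proof -
  have m: "freq lam > 0" by (rule freq_pos[OF assms])
  have "weight lam s * (profile lam \<sigma> s)\<^sup>2 = (cos (freq lam / 2 * s + - (\<sigma> * freq lam / 2)))\<^sup>2" for s
    using weight_pos[OF assms, of s]
    by (simp add: profile_def power_mult_distrib power_inverse algebra_simps diff_divide_distrib)
  moreover have "2 * (freq lam / 2 * (\<sigma> + pi / freq lam) + - (\<sigma> * freq lam / 2)) = pi"
    "2 * (freq lam / 2 * (\<sigma> - pi / freq lam) + - (\<sigma> * freq lam / 2)) = - pi"
    using m by (simp_all add: field_simps)
  ultimately show ?thesis
    using has_integral_cos_sq[of "\<sigma> - pi / freq lam" "\<sigma> + pi / freq lam" "freq lam / 2"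
        "- (\<sigma> * freq lam / 2)"] m
    by simp
qed

section \<open>Instability of long cylinders\<close>

definition test_fun :: "real \<Rightarrow> real \<Rightarrow> real \<Rightarrow> real \<times> real \<Rightarrow> real" where
  "test_fun lam \<sigma> L = (\<lambda>p. profile lam \<sigma> (fst p) * sin (2 * pi / L * snd p))"

lemma test_fun_smooth:
  assumes "lam > 1"
  shows "smooth_near K (test_fun lam \<sigma> L)"
proof (rule elem_fun_smooth_near)
  have fst: "elem_fun (\<lambda>p::real \<times> real. fst p)" and snd: "elem_fun (\<lambda>p::real \<times> real. snd p)"
    by (auto intro: elem_fun.linear bounded_linear_fst bounded_linear_snd)
  \<comment> \<open>Written with sums and products only, so that the rules of the class apply syntactically.\<close>
  have eq: "test_fun lam \<sigma> L = (\<lambda>p. cos ((fst p + - \<sigma>) * (freq lam / 2))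
      * inverse (sqrt (lam + - 1 * cos (fst p * freq lam))) * sin (2 * pi / L * snd p))"
    by (simp add: test_fun_def profile_def weight_def)
  have pos: "lam + - 1 * cos x > 0" for x
    using assms cos_le_one[of x] by linarith
  \<comment> \<open>All rules but \<open>linear\<close>, which as a backward step matches every function.\<close>
  show "elem_fun (test_fun lam \<sigma> L)"
    unfolding eq by (intro elem_fun.intros(1,3-) fst snd pos)
qed

lemma test_fun_vanishes_on_frontier:
  assumes "lam > 1" "L > 0" "p \<in> frontier (cyl_domain (pi / freq lam) \<sigma> L)"
  shows "test_fun lam \<sigma> L p = 0"
proof -
  obtain s t where p: "p = (s, t)" by (cases p)
  have "cyl_domain (pi / freq lam) \<sigma> L
      = cbox (- (pi / freq lam) + \<sigma>, 0) (pi / freq lam + \<sigma>, L)"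
    by (simp add: cyl_domain_def cbox_Pair_eq)
  then have "p \<in> cbox (- (pi / freq lam) + \<sigma>, 0) (pi / freq lam + \<sigma>, L)
      - box (- (pi / freq lam) + \<sigma>, 0) (pi / freq lam + \<sigma>, L)"
    using assms(3) by (simp add: frontier_cbox)
  then have "s = \<sigma> - pi / freq lam \<or> s = \<sigma> + pi / freq lam \<or> t = 0 \<or> t = L"
    by (auto simp: p mem_box Basis_prod_def)
  then show ?thesis
    using profile_endpoints[OF assms(1), of \<sigma>] assms(2)
    by (auto simp: test_fun_def p)
qed

lemma test_fun_mean_zero:
  assumes "lam > 1" "L > 0"
  shows "weighted_integral (vector [0, 0, 1]) (soliton_cyl lam) (cyl_domain (pi / freq lam) \<sigma> L)
    (test_fun lam \<sigma> L) = 0"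
proof -
  define a b where "a = - (pi / freq lam) + \<sigma>" and "b = pi / freq lam + \<sigma>"
  have cont: "continuous_on {a..b} (\<lambda>s. profile lam \<sigma> s * weight lam s)"
    by (rule continuous_on_mult[OF
          DERIV_continuous_on[OF has_field_derivative_at_within[OF profile_deriv[OF assms(1)]]]
          DERIV_continuous_on[OF has_field_derivative_at_within[OF weight_deriv]]])
  have "((\<lambda>t. sin (2 * pi / L * t)) has_integral
      (- cos (2 * pi / L * L) / (2 * pi / L) - - cos (2 * pi / L * 0) / (2 * pi / L))) {0..L}"
    using assms(2)
    by (intro fundamental_theorem_of_calculus)
      (auto intro!: derivative_eq_intros
        simp: has_real_derivative_iff_has_vector_derivative[symmetric])
  then have sin0: "((\<lambda>t. sin (2 * pi / L * t)) has_integral 0) {0..L}"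
    using assms(2) by simp
  have "((\<lambda>p. profile lam \<sigma> (fst p) * weight lam (fst p) * sin (2 * pi / L * snd p))
      has_integral integral {a..b} (\<lambda>s. profile lam \<sigma> s * weight lam s) * 0) ({a..b} \<times> {0..L})"
    by (rule has_integral_product[OF cont integrable_integral[OF integrable_continuous_real[OF cont]] _ sin0])
      (intro continuous_intros)
  then show ?thesis
    by (simp add: weighted_integral_soliton_cyl[OF assms(1)] cyl_domain_def a_def b_def
        test_fun_def integral_unique mult_ac)
qed

text \<open>Separation of variables. The \<open>s\<close>-derivative is paired with \<open>sin\<^sup>2\<close> and the \<open>t\<close>-derivative with
  \<open>cos\<^sup>2\<close>, so the integrand is a sum of two products of functions of one variable each.\<close>

lemma second_variation_test_fun:
  assumes "lam > 1" "L > 0"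
  shows "second_variation (vector [0, 0, 1]) (soliton_cyl lam) (cyl_domain (pi / freq lam) \<sigma> L)
      (test_fun lam \<sigma> L)
    = L / 2 * pi * ((2 * pi / L)\<^sup>2 / freq lam - 3 / 4 * (lam + cos (\<sigma> * freq lam)))"
proof -
  define m where "m = freq lam"
  define \<omega> where "\<omega> = 2 * pi / L"
  define f where "f = profile lam \<sigma>"
  define h where "h = coprofile lam \<sigma>"
  define W where "W = weight lam"
  define d where "d = lam + cos (\<sigma> * m)"
  define a b where "a = \<sigma> - pi / m" and "b = \<sigma> + pi / m"
  have domain: "cyl_domain (pi / m) \<sigma> L = {a..b} \<times> {0..L}"
    by (simp add: cyl_domain_def a_def b_def add.commute)
  define q where "q = (\<lambda>s. (h s)\<^sup>2 / (4 * W s) - m ^ 4 * (f s)\<^sup>2 / W s)"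
  have \<omega>: "\<omega> > 0" "\<omega> * L = 2 * pi" using assms(2) by (simp_all add: \<omega>_def)
  have W: "W s > 0" for s using weight_pos[OF assms(1)] by (simp add: W_def)
  have contW: "continuous_on S W" for S
    unfolding W_def by (rule DERIV_continuous_on[OF has_field_derivative_at_within[OF weight_deriv]])
  have contf: "continuous_on S f" for S
    unfolding f_def
    by (rule DERIV_continuous_on[OF has_field_derivative_at_within[OF profile_deriv[OF assms(1)]]])
  have conth: "continuous_on S h" for S
    unfolding h_def
    by (rule DERIV_continuous_on[OF has_field_derivative_at_within[OF coprofile_deriv[OF assms(1)]]])
  have W0: "W s \<noteq> 0" for s using W[of s] by simp
  have contq: "continuous_on {a..b} q"
    unfolding q_def by (intro continuous_intros contW contf conth) (auto simp: W0)
  have contWf: "continuous_on {a..b} (\<lambda>s. W s * (f s)\<^sup>2)"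
    by (intro continuous_intros contW contf)
  have intq: "(q has_integral - (3 / 4) * pi * d) {a..b}"
    using profile_curve_energy_integral[OF assms(1), of \<sigma>]
    by (simp add: q_def h_def W_def m_def f_def d_def a_def b_def)
  have intWf: "((\<lambda>s. W s * (f s)\<^sup>2) has_integral pi / m) {a..b}"
    using profile_weighted_L2_integral[OF assms(1), of \<sigma>]
    by (simp add: W_def m_def f_def a_def b_def)
  have per: "sin (2 * (\<omega> * L) + 2 * e) = sin (2 * e)" for e
  proof -
    have "2 * (\<omega> * L) + 2 * e = (2 * e + 2 * pi) + 2 * pi" by (simp add: \<omega>(2))
    then show ?thesis by (simp only: sin_periodic)
  qed
  have cos2: "((\<lambda>t. (cos (\<omega> * t + e))\<^sup>2) has_integral L / 2) {0..L}" for e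
    using has_integral_cos_sq[of 0 L \<omega> e] assms(2) \<omega>(1) by (simp add: per)
  \<comment> \<open>The integral of \<open>sin\<^sup>2\<close> is that of \<open>cos\<^sup>2\<close> with a quarter-period phase shift.\<close>
  have "cos (x + - (pi / 2)) = sin x" for x :: real by (simp add: cos_diff)
  then have intsin: "((\<lambda>t. (sin (\<omega> * t))\<^sup>2) has_integral L / 2) {0..L}"
    using cos2[of "- (pi / 2)"] by simp
  have intcos: "((\<lambda>t. \<omega>\<^sup>2 * (cos (\<omega> * t))\<^sup>2) has_integral \<omega>\<^sup>2 * (L / 2)) {0..L}"
    using has_integral_mult_right[OF cos2[of 0], of "\<omega>\<^sup>2"] by simp
  have int: "((\<lambda>p. q (fst p) * (sin (\<omega> * snd p))\<^sup>2
        + W (fst p) * (f (fst p))\<^sup>2 * (\<omega>\<^sup>2 * (cos (\<omega> * snd p))\<^sup>2))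
      has_integral - (3 / 4) * pi * d * (L / 2) + pi / m * (\<omega>\<^sup>2 * (L / 2))) ({a..b} \<times> {0..L})"
    by (intro has_integral_add has_integral_product contq intq contWf intWf intsin intcos
        continuous_intros)
  have integrand: "((norm (surf_grad (soliton_cyl lam) (test_fun lam \<sigma> L) p))\<^sup>2
        - norm_A_sq (soliton_cyl lam) p * (test_fun lam \<sigma> L p)\<^sup>2) * W (fst p)
      = q (fst p) * (sin (\<omega> * snd p))\<^sup>2
        + W (fst p) * (f (fst p))\<^sup>2 * (\<omega>\<^sup>2 * (cos (\<omega> * snd p))\<^sup>2)" for p
  proof -
    obtain s t where p: "p = (s, t)" by (cases p)
    have df: "(f has_real_derivative h s / (2 * W s)) (at s)"
      unfolding f_def h_def W_def by (rule profile_deriv[OF assms(1)])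
    have ds: "((\<lambda>t. sin (\<omega> * t)) has_real_derivative \<omega> * cos (\<omega> * t)) (at t)"
      by (auto intro!: derivative_eq_intros)
    have u: "test_fun lam \<sigma> L = (\<lambda>p. f (fst p) * sin (\<omega> * snd p))"
      by (simp add: test_fun_def f_def \<omega>_def)
    have factor: "((x * S)\<^sup>2 + (F * (\<omega> * C))\<^sup>2 - y\<^sup>2 * (F * S)\<^sup>2) * V
        = (x\<^sup>2 * V - (y\<^sup>2 * V) * F\<^sup>2) * S\<^sup>2 + V * F\<^sup>2 * (\<omega>\<^sup>2 * C\<^sup>2)" for x y S C F V :: real
      by (simp add: power_mult_distrib algebra_simps)
    have hW: "(h s / (2 * W s))\<^sup>2 * W s = (h s)\<^sup>2 / (4 * W s)"
      using W0[of s] by (simp add: power_divide power_mult_distrib power2_eq_square[of "W s"])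
    have mW: "(m\<^sup>2 / W s)\<^sup>2 * W s = m ^ 4 / W s"
      using W0[of s] by (simp add: power_divide power2_eq_square[of "W s"])
    show ?thesis
      unfolding norm_surf_grad_soliton_cyl[OF assms(1)] norm_A_sq_soliton_cyl[OF assms(1)] u p
        partial_d_product[OF df ds] m_def[symmetric] W_def[symmetric] q_def fst_conv snd_conv
        factor hW mW
      by simp
  qed
  have "second_variation (vector [0, 0, 1]) (soliton_cyl lam) (cyl_domain (pi / m) \<sigma> L)
      (test_fun lam \<sigma> L) = - (3 / 4) * pi * d * (L / 2) + pi / m * (\<omega>\<^sup>2 * (L / 2))"
    unfolding second_variation_def weighted_integral_soliton_cyl[OF assms(1)]
      W_def[symmetric] integrand domain
    by (rule integral_unique[OF int])
  then show ?thesis by (simp add: m_def d_def \<omega>_def algebra_simps)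
qed

theorem theorem4p1:
  fixes lam s0 \<sigma> L L0 :: real
  assumes "lam > 1"
    and "s0 = pi / sqrt (lam\<^sup>2 - 1)"
    and "0 \<le> \<sigma>" and "\<sigma> \<le> s0"
    and "L0 = 4 * pi / sqrt (3 * (lam + cos (\<sigma> * sqrt (lam\<^sup>2 - 1))) * sqrt (lam\<^sup>2 - 1))"
    and "L > L0"
  shows "unstable_surf (vector [0, 0, 1]) (soliton_cyl lam) (cyl_domain s0 \<sigma> L)"
proof -
  define m where "m = freq lam"
  define d where "d = lam + cos (\<sigma> * m)"
  have m: "m > 0" using freq_pos[OF assms(1)] by (simp add: m_def)
  have s0: "s0 = pi / freq lam" by (simp add: assms(2) freq_def)
  have d: "d > 0" using assms(1) cos_ge_minus_one[of "\<sigma> * m"] unfolding d_def by linarith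
  have L0: "L0 = 4 * pi / sqrt (3 * d * m)" by (simp add: assms(5) d_def m_def freq_def)
  have "L0 > 0" using d m by (simp add: L0)
  then have L: "L > 0" using assms(6) by simp
  have "L0\<^sup>2 < L\<^sup>2" using \<open>L0 > 0\<close> assms(6) by (simp add: power_strict_mono)
  then have "16 * pi\<^sup>2 / (3 * d * m) < L\<^sup>2"
    using d m by (simp add: L0 power_divide power_mult_distrib)
  then have "(2 * pi / L)\<^sup>2 / m < 3 / 4 * d"
    using d m L by (simp add: power_divide power_mult_distrib field_simps)
  then have "second_variation (vector [0, 0, 1]) (soliton_cyl lam) (cyl_domain s0 \<sigma> L)
      (test_fun lam \<sigma> L) < 0"
    unfolding s0 second_variation_test_fun[OF assms(1) L]
    unfolding m_def[symmetric] d_def[symmetric]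
    using L by (simp add: mult_pos_neg)
  moreover have "smooth_near (cyl_domain s0 \<sigma> L) (test_fun lam \<sigma> L)"
    by (rule test_fun_smooth[OF assms(1)])
  moreover have "\<forall>p\<in>frontier (cyl_domain s0 \<sigma> L). test_fun lam \<sigma> L p = 0"
    unfolding s0 using test_fun_vanishes_on_frontier[OF assms(1) L] by blast
  moreover have "weighted_integral (vector [0, 0, 1]) (soliton_cyl lam) (cyl_domain s0 \<sigma> L)
      (test_fun lam \<sigma> L) = 0"
    unfolding s0 by (rule test_fun_mean_zero[OF assms(1) L])
  ultimately show ?thesis
    unfolding unstable_surf_def stable_surf_def by (meson not_less)
qed

end
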